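(* Let $(A,\rhd,\lhd,\delta_{\rhd,r},\delta_{\lhd,r})$ be a factorizable bi-dialgebra. Then $\mathrm{Im}(\widetilde{r}\oplus\widetilde{r}^t)=\{(\widetilde r(a^* ),\widetilde r^t(a^* )):a^*\in A^*\}$ is a dialgebra subalgebra of the direct sum dialgebra $A\oplus A$, which is isomorphic to the dialgebra $(A^*,\rhd_r,\lhd_r)$, where $$a^*\rhd_r b^*=-R_{\lhd}^*(\widetilde{r}(a^* ))b^*-L_{\star}^*(\widetilde{r}^t(b^* ))a^*,\qquad a^*\lhd_r b^*=R_{\star}^*(\widetilde{r}(a^* ))b^*-L_{\rhd}^*(\widetilde{r}^t(b^* ))a^*,\qquad a^*,b^*\in A^*.$$ Moreover, any $x\in A$ has a unique decomposition $x=x_+-x_-$ with $(x_+,x_-)\in\mathrm{Im}(\widetilde{r}\oplus\widetilde{r}^t)$.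
   Context: All vector spaces and algebras are finite-dimensional over a field $\mathbb F$ of characteristic $0$; algebras are not assumed unital. **Dialgebra.** $(A,\rhd,\lhd)$ where $\rhd,\lhd$ are associative bilinear products with $(x\lhd y)\lhd z=x\lhd(y\rhd z)$, $(x\rhd y)\lhd z=x\rhd(y\lhd z)$, $(x\lhd y)\rhd z=x\rhd(y\rhd z)$. The direct sum dialgebra $A\oplus A$ has componentwise products. **Notation.** $x\star y=x\rhd y-x\lhd y$; $L_\diamond(x)y=x\diamond y=R_\diamond(y)x$; $\tau(x\otimes y)=y\otimes x$. For linear $\varphi:A\to\mathrm{End}(V)$, $\varphi^*:A\to\mathrm{End}(V^* )$ is given by $\langle\varphi^*(x)v^*,u\rangle=-\langle v^*,\varphi(x)u\rangle$. For $r\in A\otimes A$: $\langle\widetilde{r}(u^* ),v^*\rangle=\langle r,u^*\otimes v^*\rangle=\langle\widetilde{r}^t(v^* ),u^*\rangle$ defines $\widetilde r,\widetilde r^t:A^*\to A$. **Factorizable bi-dialgebra.** For $r=\sum_i a_i\otimes b_i\in A\otimes A$ and $x\in A$ put $E(x)=R_{\star}(x)\otimes\mathrm{id}+\mathrm{id}\otimes L_{\lhd}(x)$, $F(x)=R_{\rhd}(x)\otimes\mathrm{id}-\mathrm{id}\otimes L_{\star}(x)$, $\delta_{\rhd,r}(x)=E(x)r$, $\delta_{\lhd,r}(x)=F(x)r$. $r$ is a solution of the diassociative Yang-Baxter equation (DAYBE) if $\sum_{i,j}\big(a_i\otimes a_j\otimes b_i\rhd b_j-a_j\otimes a_i\lhd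 b_j\otimes b_i-a_i\star a_j\otimes b_i\otimes b_j\big)=0$. An element $s\in A\otimes A$ is invariant if $E(x)s=F(x)s=0$ for all $x$. The skew-symmetric part of $r$ is $\alpha=r-\tau(r)$. If $r$ is a solution of the DAYBE and $\alpha$ is invariant, then $(A,\rhd,\lhd,\delta_{\rhd,r},\delta_{\lhd,r})$ is a bi-dialgebra (a dialgebra and a co-dialgebra satisfying certain compatibility conditions, which hold automatically for such $r$), called quasi-triangular; it is called factorizable if moreover $\widetilde{\alpha}=\widetilde r-\widetilde r^t:A^*\to A$ is a linear isomorphism. Thus the hypothesis is: $r$ solves the DAYBE, $\alpha$ is invariant and $\widetilde\alpha$ is bijective. *)

theory Defs
  imports "HOL-Analysis.Product_Vector" "HOL-Library.Function_Algebras"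
begin

section \<open>Dialgebras\<close>

text \<open>Scalar multiplications are explicit parameters and algebras are linear subspaces \<open>V\<close> of an
  ambient vector space, since dual spaces and images below are proper subsets of types.\<close>

definition fin_dim_space :: "('f::field \<Rightarrow> 'v::ab_group_add \<Rightarrow> 'v) \<Rightarrow> 'v set \<Rightarrow> bool" where
  "fin_dim_space s V \<longleftrightarrow>
     vector_space s \<and> module.subspace s V \<and> (\<exists>B. finite B \<and> module.span s B = V)"

definition bilinear_product_on ::
  "('f::field \<Rightarrow> 'v::ab_group_add \<Rightarrow> 'v) \<Rightarrow> 'v set \<Rightarrow> ('v \<Rightarrow> 'v \<Rightarrow> 'v) \<Rightarrow> bool" where
  "bilinear_product_on s V m \<longleftrightarrow>
     (\<forall>x\<in>V. \<forall>y\<in>V. m x y \<in> V) \<and>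
     (\<forall>x\<in>V. \<forall>y\<in>V. \<forall>z\<in>V. m (x + y) z = m x z + m y z \<and> m z (x + y) = m z x + m z y) \<and>
     (\<forall>c. \<forall>x\<in>V. \<forall>y\<in>V. m (s c x) y = s c (m x y) \<and> m x (s c y) = s c (m x y))"

definition dialgebra_on ::
  "('f::field \<Rightarrow> 'v::ab_group_add \<Rightarrow> 'v) \<Rightarrow> 'v set \<Rightarrow>
   ('v \<Rightarrow> 'v \<Rightarrow> 'v) \<Rightarrow> ('v \<Rightarrow> 'v \<Rightarrow> 'v) \<Rightarrow> bool" where
  "dialgebra_on s V rt lt \<longleftrightarrow>
     fin_dim_space s V \<and> bilinear_product_on s V rt \<and> bilinear_product_on s V lt \<and>
     (\<forall>x\<in>V. \<forall>y\<in>V. \<forall>z\<in>V.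
        rt (rt x y) z = rt x (rt y z) \<and>
        lt (lt x y) z = lt x (lt y z) \<and>
        lt (lt x y) z = lt x (rt y z) \<and>
        lt (rt x y) z = rt x (lt y z) \<and>
        rt (lt x y) z = rt x (rt y z))"

definition subdialgebra ::
  "'v set \<Rightarrow> ('f::field \<Rightarrow> 'v::ab_group_add \<Rightarrow> 'v) \<Rightarrow> 'v set \<Rightarrow>
   ('v \<Rightarrow> 'v \<Rightarrow> 'v) \<Rightarrow> ('v \<Rightarrow> 'v \<Rightarrow> 'v) \<Rightarrow> bool" where
  "subdialgebra S s V rt lt \<longleftrightarrow>
     dialgebra_on s V rt lt \<and> S \<subseteq> V \<and> module.subspace s S \<and>
     (\<forall>x\<in>S. \<forall>y\<in>S. rt x y \<in> S \<and> lt x y \<in> S)"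

definition dialgebra_isomorphic ::
  "('f::field \<Rightarrow> 'v::ab_group_add \<Rightarrow> 'v) \<Rightarrow> 'v set \<Rightarrow>
   ('v \<Rightarrow> 'v \<Rightarrow> 'v) \<Rightarrow> ('v \<Rightarrow> 'v \<Rightarrow> 'v) \<Rightarrow>
   ('f \<Rightarrow> 'w::ab_group_add \<Rightarrow> 'w) \<Rightarrow> 'w set \<Rightarrow>
   ('w \<Rightarrow> 'w \<Rightarrow> 'w) \<Rightarrow> ('w \<Rightarrow> 'w \<Rightarrow> 'w) \<Rightarrow> bool" where
  "dialgebra_isomorphic s V rt lt s' W rt' lt' \<longleftrightarrow>
     dialgebra_on s V rt lt \<and> dialgebra_on s' W rt' lt' \<and>
     (\<exists>f. bij_betw f V W \<and>
        (\<forall>x\<in>V. \<forall>y\<in>V. f (x + y) = f x + f y) \<and>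
        (\<forall>c. \<forall>x\<in>V. f (s c x) = s' c (f x)) \<and>
        (\<forall>x\<in>V. \<forall>y\<in>V. f (rt x y) = rt' (f x) (f y) \<and> f (lt x y) = lt' (f x) (f y)))"

definition prod_scale ::
  "('f::field \<Rightarrow> 'v::ab_group_add \<Rightarrow> 'v) \<Rightarrow> 'f \<Rightarrow> 'v \<times> 'v \<Rightarrow> 'v \<times> 'v" where
  "prod_scale s = module_prod.scale s s"

definition prod_mult :: "('v \<Rightarrow> 'v \<Rightarrow> 'v) \<Rightarrow> 'v \<times> 'v \<Rightarrow> 'v \<times> 'v \<Rightarrow> 'v \<times> 'v" where
  "prod_mult m p q = (m (fst p) (fst q), m (snd p) (snd q))"

definition star_prod ::
  "('v \<Rightarrow> 'v \<Rightarrow> 'v::ab_group_add) \<Rightarrow> ('v \<Rightarrow> 'v \<Rightarrow> 'v) \<Rightarrow> 'v \<Rightarrow> 'v \<Rightarrow> 'v" where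
  "star_prod rt lt x y = rt x y - lt x y"

definition left_mult :: "('v \<Rightarrow> 'v \<Rightarrow> 'v) \<Rightarrow> 'v \<Rightarrow> 'v \<Rightarrow> 'v" where
  "left_mult m x = (\<lambda>y. m x y)"

definition right_mult :: "('v \<Rightarrow> 'v \<Rightarrow> 'v) \<Rightarrow> 'v \<Rightarrow> 'v \<Rightarrow> 'v" where
  "right_mult m y = (\<lambda>x. m x y)"

section \<open>Dual space\<close>

definition dual :: "('f::field \<Rightarrow> 'a::ab_group_add \<Rightarrow> 'a) \<Rightarrow> ('a \<Rightarrow> 'f) set" where
  "dual s = {u. Vector_Spaces.linear s (*) u}"

definition fun_scale :: "'f::field \<Rightarrow> ('a \<Rightarrow> 'f) \<Rightarrow> 'a \<Rightarrow> 'f" where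
  "fun_scale c u = (\<lambda>x. c * u x)"

definition dual_rep :: "('a \<Rightarrow> 'a \<Rightarrow> 'a) \<Rightarrow> 'a \<Rightarrow> ('a \<Rightarrow> 'f::field) \<Rightarrow> 'a \<Rightarrow> 'f" where
  "dual_rep \<phi> x v = (\<lambda>u. - v (\<phi> x u))"

section \<open>Tensors\<close>

text \<open>For a finite-dimensional space \<open>A\<close>, the tensor products \<open>A \<otimes> A\<close> and \<open>A \<otimes> A \<otimes> A\<close> are realised
  through the canonical identification with bilinear resp. trilinear forms on \<open>A\<^sup>*\<close>: the tensor \<open>r\<close>
  is the form \<open>(u, v) \<mapsto> \<langle>r, u \<otimes> v\<rangle>\<close>. All forms are set to 0 outside the dual space, so that
  equality and the pointwise vector space operations of functions are those of tensors.\<close>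

type_synonym ('a, 'f) tensor2 = "('a \<Rightarrow> 'f) \<Rightarrow> ('a \<Rightarrow> 'f) \<Rightarrow> 'f"
type_synonym ('a, 'f) tensor3 = "('a \<Rightarrow> 'f) \<Rightarrow> ('a \<Rightarrow> 'f) \<Rightarrow> ('a \<Rightarrow> 'f) \<Rightarrow> 'f"

definition tens2 ::
  "('f::field \<Rightarrow> 'a::ab_group_add \<Rightarrow> 'a) \<Rightarrow> 'a \<Rightarrow> 'a \<Rightarrow> ('a, 'f) tensor2" where
  "tens2 s a b = (\<lambda>u v. if u \<in> dual s \<and> v \<in> dual s then u a * v b else 0)"

definition tens3 ::
  "('f::field \<Rightarrow> 'a::ab_group_add \<Rightarrow> 'a) \<Rightarrow> 'a \<Rightarrow> 'a \<Rightarrow> 'a \<Rightarrow> ('a, 'f) tensor3" where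
  "tens3 s a b c =
     (\<lambda>u v w. if u \<in> dual s \<and> v \<in> dual s \<and> w \<in> dual s then u a * v b * w c else 0)"

definition tensor_square ::
  "('f::field \<Rightarrow> 'a::ab_group_add \<Rightarrow> 'a) \<Rightarrow> ('a, 'f) tensor2 set" where
  "tensor_square s = {\<Sum>i<n. tens2 s (a i) (b i) | (n::nat) a b. True}"

definition flip :: "('a, 'f) tensor2 \<Rightarrow> ('a, 'f) tensor2" where
  "flip t = (\<lambda>u v. t v u)"

text \<open>The map \<open>f \<otimes> g\<close> on \<open>A \<otimes> A\<close>, for linear \<open>f\<close> and \<open>g\<close>; see \<open>tensor_map_tens2\<close>.\<close>

definition tensor_map ::
  "('f::field \<Rightarrow> 'a::ab_group_add \<Rightarrow> 'a) \<Rightarrow> ('a \<Rightarrow> 'a) \<Rightarrow> ('a \<Rightarrow> 'a) \<Rightarrow>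
   ('a, 'f) tensor2 \<Rightarrow> ('a, 'f) tensor2" where
  "tensor_map s f g t =
     (\<lambda>u v. if u \<in> dual s \<and> v \<in> dual s then t (u \<circ> f) (v \<circ> g) else 0)"

definition tilde ::
  "('f::field \<Rightarrow> 'a::ab_group_add \<Rightarrow> 'a) \<Rightarrow> ('a, 'f) tensor2 \<Rightarrow> ('a \<Rightarrow> 'f) \<Rightarrow> 'a" where
  "tilde s r u = (THE x. \<forall>v\<in>dual s. v x = r u v)"

definition tilde_t ::
  "('f::field \<Rightarrow> 'a::ab_group_add \<Rightarrow> 'a) \<Rightarrow> ('a, 'f) tensor2 \<Rightarrow> ('a \<Rightarrow> 'f) \<Rightarrow> 'a" where
  "tilde_t s r v = (THE x. \<forall>u\<in>dual s. u x = r u v)"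

lemma flip_tens2: "flip (tens2 s a b) = tens2 s b a"
  by (auto simp: flip_def tens2_def fun_eq_iff)

lemma dual_comp:
  assumes "u \<in> dual s" "Vector_Spaces.linear s s f"
  shows "u \<circ> f \<in> dual s"
  using assms unfolding dual_def by (auto intro: Vector_Spaces.linear_compose)

lemma tensor_map_tens2:
  assumes "Vector_Spaces.linear s s f" "Vector_Spaces.linear s s g"
  shows "tensor_map s f g (tens2 s a b) = tens2 s (f a) (g b)"
  using assms by (auto simp: tensor_map_def tens2_def fun_eq_iff dual_comp)

section \<open>Factorizable bi-dialgebras\<close>

definition E_op ::
  "('f::field \<Rightarrow> 'a::ab_group_add \<Rightarrow> 'a) \<Rightarrow> ('a \<Rightarrow> 'a \<Rightarrow> 'a) \<Rightarrow> ('a \<Rightarrow> 'a \<Rightarrow> 'a) \<Rightarrow>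
   'a \<Rightarrow> ('a, 'f) tensor2 \<Rightarrow> ('a, 'f) tensor2" where
  "E_op s rt lt x t =
     tensor_map s (right_mult (star_prod rt lt) x) id t + tensor_map s id (left_mult lt x) t"

definition F_op ::
  "('f::field \<Rightarrow> 'a::ab_group_add \<Rightarrow> 'a) \<Rightarrow> ('a \<Rightarrow> 'a \<Rightarrow> 'a) \<Rightarrow> ('a \<Rightarrow> 'a \<Rightarrow> 'a) \<Rightarrow>
   'a \<Rightarrow> ('a, 'f) tensor2 \<Rightarrow> ('a, 'f) tensor2" where
  "F_op s rt lt x t =
     tensor_map s (right_mult rt x) id t - tensor_map s id (left_mult (star_prod rt lt) x) t"

definition invariant_tensor ::
  "('f::field \<Rightarrow> 'a::ab_group_add \<Rightarrow> 'a) \<Rightarrow> ('a \<Rightarrow> 'a \<Rightarrow> 'a) \<Rightarrow> ('a \<Rightarrow> 'a \<Rightarrow> 'a) \<Rightarrow>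
   ('a, 'f) tensor2 \<Rightarrow> bool" where
  "invariant_tensor s rt lt t \<longleftrightarrow> (\<forall>x. E_op s rt lt x t = 0 \<and> F_op s rt lt x t = 0)"

text \<open>The left-hand side of the diassociative Yang-Baxter equation does not depend on the chosen
  expression \<open>r = \<Sum>i. a\<^sub>i \<otimes> b\<^sub>i\<close>, so asking for one expression is the same as asking for all.\<close>

definition daybe_solution ::
  "('f::field \<Rightarrow> 'a::ab_group_add \<Rightarrow> 'a) \<Rightarrow> ('a \<Rightarrow> 'a \<Rightarrow> 'a) \<Rightarrow> ('a \<Rightarrow> 'a \<Rightarrow> 'a) \<Rightarrow>
   ('a, 'f) tensor2 \<Rightarrow> bool" where
  "daybe_solution s rt lt r \<longleftrightarrow>
     (\<exists>(n::nat) a b. r = (\<Sum>i<n. tens2 s (a i) (b i)) \<and>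
        (\<Sum>i<n. \<Sum>j<n.
            tens3 s (a i) (a j) (rt (b i) (b j))
          - tens3 s (a j) (lt (a i) (b j)) (b i)
          - tens3 s (star_prod rt lt (a i) (a j)) (b i) (b j)) = 0)"

definition skew_part :: "('a, 'f::ab_group_add) tensor2 \<Rightarrow> ('a, 'f) tensor2" where
  "skew_part r = r - flip r"

text \<open>The comultiplications \<open>x \<mapsto> E(x) r\<close> and \<open>x \<mapsto> F(x) r\<close> of the bi-dialgebra are determined by
  \<open>r\<close>, and their compatibility with the products is automatic, so the structure is given by the
  dialgebra together with \<open>r\<close>.\<close>

definition quasi_triangular_bidialgebra ::
  "('f::field \<Rightarrow> 'a::ab_group_add \<Rightarrow> 'a) \<Rightarrow> ('a \<Rightarrow> 'a \<Rightarrow> 'a) \<Rightarrow> ('a \<Rightarrow> 'a \<Rightarrow> 'a) \<Rightarrow>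
   ('a, 'f) tensor2 \<Rightarrow> bool" where
  "quasi_triangular_bidialgebra s rt lt r \<longleftrightarrow>
     dialgebra_on s UNIV rt lt \<and> r \<in> tensor_square s \<and>
     daybe_solution s rt lt r \<and> invariant_tensor s rt lt (skew_part r)"

definition factorizable_bidialgebra ::
  "('f::field \<Rightarrow> 'a::ab_group_add \<Rightarrow> 'a) \<Rightarrow> ('a \<Rightarrow> 'a \<Rightarrow> 'a) \<Rightarrow> ('a \<Rightarrow> 'a \<Rightarrow> 'a) \<Rightarrow>
   ('a, 'f) tensor2 \<Rightarrow> bool" where
  "factorizable_bidialgebra s rt lt r \<longleftrightarrow>
     quasi_triangular_bidialgebra s rt lt r \<and> bij_betw (tilde s (skew_part r)) (dual s) UNIV"

definition image_sum ::
  "('f::field \<Rightarrow> 'a::ab_group_add \<Rightarrow> 'a) \<Rightarrow> ('a, 'f) tensor2 \<Rightarrow> ('a \<times> 'a) set" where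
  "image_sum s r = {(tilde s r u, tilde_t s r u) | u. u \<in> dual s}"

definition dual_rt ::
  "('f::field \<Rightarrow> 'a::ab_group_add \<Rightarrow> 'a) \<Rightarrow> ('a \<Rightarrow> 'a \<Rightarrow> 'a) \<Rightarrow> ('a \<Rightarrow> 'a \<Rightarrow> 'a) \<Rightarrow>
   ('a, 'f) tensor2 \<Rightarrow> ('a \<Rightarrow> 'f) \<Rightarrow> ('a \<Rightarrow> 'f) \<Rightarrow> 'a \<Rightarrow> 'f" where
  "dual_rt s rt lt r u v =
     - dual_rep (right_mult lt) (tilde s r u) v
     - dual_rep (left_mult (star_prod rt lt)) (tilde_t s r v) u"

definition dual_lt ::
  "('f::field \<Rightarrow> 'a::ab_group_add \<Rightarrow> 'a) \<Rightarrow> ('a \<Rightarrow> 'a \<Rightarrow> 'a) \<Rightarrow> ('a \<Rightarrow> 'a \<Rightarrow> 'a) \<Rightarrow>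
   ('a, 'f) tensor2 \<Rightarrow> ('a \<Rightarrow> 'f) \<Rightarrow> ('a \<Rightarrow> 'f) \<Rightarrow> 'a \<Rightarrow> 'f" where
  "dual_lt s rt lt r u v =
     dual_rep (right_mult (star_prod rt lt)) (tilde s r u) v
     - dual_rep (left_mult rt) (tilde_t s r v) u"

end

theory Submission
  imports Defs
begin

text \<open>Write \<open>R, T : A\<^sup>* \<rightarrow> A\<close> for the two contractions of \<open>r\<close> and \<open>P = R - T\<close>. Pairing the DAYBE with
  three functionals and moving everything onto one of them gives the multiplicativity of \<open>R\<close> for
  \<open>\<rhd>\<close>, of \<open>T\<close> for \<open>\<star>\<close>, and one mixed identity for \<open>T w \<lhd> R u\<close>. Invariance of the skew part
  says that \<open>P\<close> intertwines the dual multiplications of \<open>A\<close> with the multiplications; substituting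
  \<open>T = R - P\<close> resp. \<open>R = T + P\<close> in the mixed identity then yields that \<open>R\<close> and \<open>T\<close> are also
  multiplicative for \<open>\<lhd>\<close>. Hence \<open>u \<mapsto> (R u, T u)\<close> is a homomorphism into \<open>A \<oplus> A\<close>, which is
  injective, and decomposes every element uniquely, because \<open>P\<close> is bijective.\<close>

section \<open>Linear algebra\<close>

lemma sum_fun_apply: "(\<Sum>i\<in>I. f i) x = (\<Sum>i\<in>I. f i x)"
  by (induction I rule: infinite_finite_induct) auto

lemma vector_space_field_mult: "vector_space ((*) :: 'f::field \<Rightarrow> 'f \<Rightarrow> 'f)"
  by unfold_locales (auto simp: algebra_simps)

lemma fun_scale_apply: "fun_scale c u x = c * u x"
  by (simp add: fun_scale_def)

lemma vector_space_fun_scale: "vector_space (fun_scale :: 'f::field \<Rightarrow> ('a \<Rightarrow> 'f) \<Rightarrow> 'a \<Rightarrow> 'f)"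
  by unfold_locales (auto simp: algebra_simps fun_scale_def)

lemma dual_add: "u \<in> dual s \<Longrightarrow> u (x + y) = u x + u y"
  and dual_scale: "u \<in> dual s \<Longrightarrow> u (s c x) = c * u x"
  and dual_diff: "u \<in> dual s \<Longrightarrow> u (x - y) = u x - u y"
  and dual_uminus: "u \<in> dual s \<Longrightarrow> u (- x) = - u x"
  and dual_sum: "u \<in> dual s \<Longrightarrow> u (\<Sum>i\<in>I. f i) = (\<Sum>i\<in>I. u (f i))"
  unfolding dual_def mem_Collect_eq linear_iff_module_hom
  by (simp_all add: module_hom.add module_hom.scale module_hom.diff module_hom.neg
      module_hom.sum)

context vector_space
begin

lemma dual_iff:
  "u \<in> dual scale \<longleftrightarrow> (\<forall>x y. u (x + y) = u x + u y) \<and> (\<forall>c x. u (scale c x) = c * u x)"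
  unfolding dual_def mem_Collect_eq Vector_Spaces.linear_iff
  using vector_space_axioms vector_space_field_mult by auto

lemma dual_closed:
  "u \<in> dual scale \<Longrightarrow> v \<in> dual scale \<Longrightarrow> u + v \<in> dual scale"
  "u \<in> dual scale \<Longrightarrow> v \<in> dual scale \<Longrightarrow> u - v \<in> dual scale"
  "u \<in> dual scale \<Longrightarrow> fun_scale c u \<in> dual scale"
  by (auto simp: dual_iff fun_scale_def algebra_simps)

text \<open>A nonzero difference spans an independent set, so the value 1 on it extends to a
  functional. Almost every identity between vectors below is proved by pairing both sides with all
  of the dual.\<close>

lemma dual_separates:
  assumes "\<And>u. u \<in> dual scale \<Longrightarrow> u x = u y"
  shows "x = y"
proof (rule ccontr)
  assume "x \<noteq> y"
  interpret vector_space_pair scale "(*) :: 'a \<Rightarrow> 'a \<Rightarrow> 'a"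
    by (simp add: vector_space_pair_def vector_space_axioms vector_space_field_mult)
  have "independent {x - y}" using \<open>x \<noteq> y\<close> by simp
  then obtain u where u: "Vector_Spaces.linear scale (*) u" "u (x - y) = 1"
    using linear_independent_extend[of "{x - y}" "\<lambda>_. 1"] by auto
  then have "u \<in> dual scale" by (simp add: dual_def)
  then show False using u(2) assms[of u] by (simp add: dual_diff)
qed

end

text \<open>The dual and the image in A \<oplus> A get their finite dimension from this, each as a
  linear image of A; no dual basis is constructed.\<close>

lemma fin_dim_space_image:
  assumes "fin_dim_space s V" "Vector_Spaces.linear s s' f"
  shows "fin_dim_space s' (f ` V)"
proof -
  interpret f: Vector_Spaces.linear s s' f by fact
  obtain B where "finite B" "f.vs1.span B = V" and "f.vs1.subspace V"
    using assms(1) unfolding fin_dim_space_def by blast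
  then show ?thesis
    unfolding fin_dim_space_def using f.span_image[of B] f.vs2.vector_space_axioms
    by (metis f.subspace_image finite_imageI)
qed

lemma fin_dim_space_prod:
  assumes "fin_dim_space s UNIV"
  shows "fin_dim_space (prod_scale s) UNIV"
proof -
  interpret vector_space s using assms by (simp add: fin_dim_space_def)
  interpret vector_space_pair s s ..
  interpret vector_space_prod s s ..
  obtain B where B: "finite B" "span B = UNIV"
    using assms unfolding fin_dim_space_def by blast
  have "p.span (B \<times> {0} \<union> {0} \<times> B) = UNIV"
    unfolding p.span_Un span_Times_sing1 span_Times_sing2 B(2)
    by (force simp: set_eq_iff)
  moreover have "finite (B \<times> {0} \<union> {0} \<times> B)" using B(1) by auto
  ultimately show ?thesis
    unfolding fin_dim_space_def prod_scale_def
    using p.vector_space_axioms p.subspace_UNIV by blast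
qed

lemma prod_scale_Pair: "vector_space s \<Longrightarrow> prod_scale s c (x, y) = (s c x, s c y)"
  unfolding prod_scale_def
  by (subst module_prod.scale_prod)
     (auto simp: module_prod_def module_pair_def module_iff_vector_space)

section \<open>Dialgebras\<close>

lemma dialgebra_on_prod:
  assumes "dialgebra_on s UNIV rt lt"
  shows "dialgebra_on (prod_scale s) UNIV (prod_mult rt) (prod_mult lt)"
proof -
  have "vector_space s" using assms by (simp add: dialgebra_on_def fin_dim_space_def)
  note [simp] = prod_scale_Pair[OF this]
  show ?thesis
    using assms fin_dim_space_prod[of s]
    by (auto simp: dialgebra_on_def bilinear_product_on_def prod_mult_def) metis+
qed

text \<open>Each identity on \<open>W\<close> is mapped by \<open>f\<close> to one that holds in
  \<open>V\<close>, and injectivity brings it back. Applied to an inclusion and to the embedding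
  \<open>J\<close> of the dual, this avoids verifying the five associativity laws for the dual
  products by hand.\<close>

lemma dialgebra_on_pullback:
  assumes "dialgebra_on s V rt lt" "fin_dim_space s' W" "inj_on f W" "\<And>x. x \<in> W \<Longrightarrow> f x \<in> V"
    and add: "\<And>x y. x \<in> W \<Longrightarrow> y \<in> W \<Longrightarrow> f (x + y) = f x + f y"
    and scale: "\<And>c x. x \<in> W \<Longrightarrow> f (s' c x) = s c (f x)"
    and closed: "\<And>x y. x \<in> W \<Longrightarrow> y \<in> W \<Longrightarrow> rt' x y \<in> W" "\<And>x y. x \<in> W \<Longrightarrow> y \<in> W \<Longrightarrow> lt' x y \<in> W"
    and hom: "\<And>x y. x \<in> W \<Longrightarrow> y \<in> W \<Longrightarrow> f (rt' x y) = rt (f x) (f y)"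
      "\<And>x y. x \<in> W \<Longrightarrow> y \<in> W \<Longrightarrow> f (lt' x y) = lt (f x) (f y)"
  shows "dialgebra_on s' W rt' lt'"
proof -
  interpret vector_space s' using assms(2) by (simp add: fin_dim_space_def)
  have W: "subspace W" using assms(2) by (simp add: fin_dim_space_def)
  have cl: "\<And>x y. x \<in> W \<Longrightarrow> y \<in> W \<Longrightarrow> x + y \<in> W" "\<And>c x. x \<in> W \<Longrightarrow> s' c x \<in> W"
    using W by (auto intro: subspace_add subspace_scale)
  have eqI: "x = y" if "f x = f y" "x \<in> W" "y \<in> W" for x y
    using that assms(3) by (auto dest: inj_onD)
  \<comment> \<open>The third clause of \<open>assoc\<close> compares the two expressions for
    \<open>lt (lt x y) z\<close>, so that the five equations serve as rewrite rules with distinct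
    left-hand sides.\<close>
  have V: "fin_dim_space s V" "bilinear_product_on s V rt" "bilinear_product_on s V lt"
    and assoc: "\<And>x y z. x \<in> V \<Longrightarrow> y \<in> V \<Longrightarrow> z \<in> V \<Longrightarrow>
        rt (rt x y) z = rt x (rt y z) \<and>
        lt (lt x y) z = lt x (lt y z) \<and>
        lt x (rt y z) = lt x (lt y z) \<and>
        lt (rt x y) z = rt x (lt y z) \<and>
        rt (lt x y) z = rt x (rt y z)"
    using assms(1) unfolding dialgebra_on_def by (blast, blast, blast, fastforce)
  have bil: "bilinear_product_on s' W m'"
    if "bilinear_product_on s V m" "\<And>x y. x \<in> W \<Longrightarrow> y \<in> W \<Longrightarrow> m' x y \<in> W"
      "\<And>x y. x \<in> W \<Longrightarrow> y \<in> W \<Longrightarrow> f (m' x y) = m (f x) (f y)" for m m'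
  proof -
    have m: "\<And>x y z. x \<in> V \<Longrightarrow> y \<in> V \<Longrightarrow> z \<in> V \<Longrightarrow> m (x + y) z = m x z + m y z"
      "\<And>x y z. x \<in> V \<Longrightarrow> y \<in> V \<Longrightarrow> z \<in> V \<Longrightarrow> m z (x + y) = m z x + m z y"
      "\<And>c x y. x \<in> V \<Longrightarrow> y \<in> V \<Longrightarrow> m (s c x) y = s c (m x y)"
      "\<And>c x y. x \<in> V \<Longrightarrow> y \<in> V \<Longrightarrow> m x (s c y) = s c (m x y)"
      using that(1) unfolding bilinear_product_on_def by blast+
    show ?thesis
      unfolding bilinear_product_on_def
      by (intro conjI ballI allI)
        (auto intro!: eqI simp: that(2,3) m add scale cl assms(4))
  qed
  show ?thesis
    unfolding dialgebra_on_def
  proof (intro conjI ballI)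
    show "bilinear_product_on s' W rt'" using V(2) closed(1) hom(1) by (rule bil)
    show "bilinear_product_on s' W lt'" using V(3) closed(2) hom(2) by (rule bil)
  qed (use assms(2) in \<open>auto intro!: eqI closed simp: hom closed assoc assms(4)\<close>)
qed

section \<open>Factorizable bi-dialgebras\<close>

locale factorizable =
  fixes scale :: "'f::field_char_0 \<Rightarrow> 'a::ab_group_add \<Rightarrow> 'a"
    and rt lt :: "'a \<Rightarrow> 'a \<Rightarrow> 'a"
    and r :: "('a, 'f) tensor2"
  assumes factorizable: "factorizable_bidialgebra scale rt lt r"
begin

lemma dialgebra: "dialgebra_on scale UNIV rt lt"
  using factorizable by (simp add: factorizable_bidialgebra_def quasi_triangular_bidialgebra_def)

sublocale vector_space scale
  using dialgebra by (simp add: dialgebra_on_def fin_dim_space_def)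

abbreviation star where "star \<equiv> star_prod rt lt"
abbreviation D where "D \<equiv> dual scale"
abbreviation R where "R \<equiv> tilde scale r"
abbreviation T where "T \<equiv> tilde_t scale r"
abbreviation P where "P u \<equiv> R u - T u"

section \<open>Linearity of the multiplications and their action on functionals\<close>

lemma product_linear:
  "rt (x + y) z = rt x z + rt y z" "rt z (x + y) = rt z x + rt z y"
  "lt (x + y) z = lt x z + lt y z" "lt z (x + y) = lt z x + lt z y"
  "rt (scale c x) z = scale c (rt x z)" "rt z (scale c x) = scale c (rt z x)"
  "lt (scale c x) z = scale c (lt x z)" "lt z (scale c x) = scale c (lt z x)"
  using dialgebra by (auto simp: dialgebra_on_def bilinear_product_on_def)

lemma star_linear:
  "star (x + y) z = star x z + star y z" "star z (x + y) = star z x + star z y"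
  "star (scale c x) z = scale c (star x z)" "star z (scale c x) = scale c (star z x)"
  by (simp_all add: star_prod_def product_linear scale_right_diff_distrib)

lemma product_additive:
  "additive (rt x)" "additive (\<lambda>z. rt z x)" "additive (lt x)" "additive (\<lambda>z. lt z x)"
  "additive (star x)" "additive (\<lambda>z. star z x)"
  by (simp_all add: additive_def product_linear star_linear)

lemmas product_diff = product_additive[THEN additive.diff]
lemmas product_sum = product_additive[THEN additive.sum]

lemma dual_mult:
  assumes "u \<in> D"
  shows "u \<circ> rt x \<in> D" "u \<circ> lt x \<in> D" "u \<circ> star x \<in> D"
    "u \<circ> (\<lambda>z. rt z x) \<in> D" "u \<circ> (\<lambda>z. lt z x) \<in> D" "u \<circ> (\<lambda>z. star z x) \<in> D"
  using assms by (auto simp: dual_iff product_linear star_linear)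

lemma daybe_representation:
  obtains n :: nat and a b where "r = (\<Sum>i<n. tens2 scale (a i) (b i))"
    "(\<Sum>i<n. \<Sum>j<n. tens3 scale (a i) (a j) (rt (b i) (b j))
        - tens3 scale (a j) (lt (a i) (b j)) (b i)
        - tens3 scale (star (a i) (a j)) (b i) (b j)) = 0"
  using factorizable
  unfolding factorizable_bidialgebra_def quasi_triangular_bidialgebra_def daybe_solution_def
  by blast

section \<open>The contractions of the tensor and their adjointness\<close>

lemma tilde_eqI:
  assumes "\<And>v. v \<in> D \<Longrightarrow> v x = t u v"
  shows "tilde scale t u = x"
  unfolding tilde_def
  by (rule the_equality) (use assms in \<open>blast, intro dual_separates, simp\<close>)

lemma tilde_t_eqI:
  assumes "\<And>u. u \<in> D \<Longrightarrow> u x = t u v"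
  shows "tilde_t scale t v = x"
  unfolding tilde_t_def
  by (rule the_equality) (use assms in \<open>blast, intro dual_separates, simp\<close>)

text \<open>A finite sum of elementary tensors supplies explicit witnesses for the definite
  descriptions in \<open>tilde\<close> and \<open>tilde_t\<close>; uniqueness comes from
  \<open>dual_separates\<close>.\<close>

lemma contractions:
  assumes "r = (\<Sum>i<n::nat. tens2 scale (a i) (b i))" and u: "u \<in> D"
  shows "R u = (\<Sum>i<n. scale (u (a i)) (b i))" "T u = (\<Sum>i<n. scale (u (b i)) (a i))"
  by (rule tilde_eqI tilde_t_eqI,
      use u in \<open>simp add: assms(1) sum_fun_apply tens2_def dual_sum dual_scale mult.commute\<close>)+

lemma R_pair: "v (R u) = r u v"
  and T_pair: "u (T v) = r u v" if "u \<in> D" "v \<in> D"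
proof -
  obtain n :: nat and a b where r: "r = (\<Sum>i<n. tens2 scale (a i) (b i))"
    using daybe_representation by metis
  show "v (R u) = r u v" "u (T v) = r u v"
    using that unfolding contractions[OF r that(1)] contractions[OF r that(2)]
    by (simp_all add: r sum_fun_apply tens2_def dual_sum dual_scale mult.commute)
qed

text \<open>\<open>R\<close> and \<open>T\<close> are transposes of each other. This is the rule for
  moving a contraction from one functional to another in all later computations.\<close>

lemma pairing: "u \<in> D \<Longrightarrow> v \<in> D \<Longrightarrow> v (R u) = u (T v)"
  by (simp add: R_pair T_pair)

lemma R_linear:
  "u \<in> D \<Longrightarrow> v \<in> D \<Longrightarrow> R (u + v) = R u + R v"
  "u \<in> D \<Longrightarrow> v \<in> D \<Longrightarrow> R (u - v) = R u - R v"
  "u \<in> D \<Longrightarrow> R (fun_scale c u) = scale c (R u)"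
  by (rule dual_separates;
      simp add: dual_add dual_scale dual_diff dual_closed fun_scale_apply pairing)+

lemma T_linear:
  "u \<in> D \<Longrightarrow> v \<in> D \<Longrightarrow> T (u + v) = T u + T v"
  "u \<in> D \<Longrightarrow> v \<in> D \<Longrightarrow> T (u - v) = T u - T v"
  "u \<in> D \<Longrightarrow> T (fun_scale c u) = scale c (T u)"
  by (rule dual_separates;
      simp add: dual_add dual_scale dual_diff dual_closed fun_scale_apply flip: pairing)+

lemmas contraction_linear = R_linear T_linear

lemma tilde_skew_part: "u \<in> D \<Longrightarrow> tilde scale (skew_part r) u = P u"
  by (rule tilde_eqI) (simp add: skew_part_def flip_def dual_diff R_pair T_pair)

lemma bij_P: "bij_betw P D UNIV"
  using factorizable bij_betw_cong[of D "tilde scale (skew_part r)" P UNIV]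
  by (simp add: factorizable_bidialgebra_def tilde_skew_part)

section \<open>Invariance and the DAYBE in terms of the contractions\<close>

lemma skew_part_pair: "u \<in> D \<Longrightarrow> v \<in> D \<Longrightarrow> skew_part r u v = v (P u)"
  by (simp add: skew_part_def flip_def dual_diff R_pair T_pair)

lemma P_skew: "u \<in> D \<Longrightarrow> v \<in> D \<Longrightarrow> v (P u) = - u (P v)"
  by (simp add: dual_diff pairing)

text \<open>The first two identities are E(x) and F(x) annihilating the skew part, paired with two
  functionals. The last two are their transposes: \<open>P_skew\<close> is applied once on each side
  of E resp. F.\<close>

lemma invariance:
  assumes u: "u \<in> D"
  shows "P (u \<circ> (\<lambda>z. star z x)) = - lt x (P u)" "P (u \<circ> (\<lambda>z. rt z x)) = star x (P u)"
    "P (u \<circ> lt x) = - star (P u) x" "P (u \<circ> star x) = rt (P u) x"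
proof -
  have inv: "E_op scale rt lt x (skew_part r) = 0" "F_op scale rt lt x (skew_part r) = 0"
    using factorizable by (auto simp: factorizable_bidialgebra_def
        quasi_triangular_bidialgebra_def invariant_tensor_def)
  have E: "v (P (w \<circ> (\<lambda>z. star z x))) + v (lt x (P w)) = 0" if "w \<in> D" "v \<in> D" for v w
    using fun_cong[OF fun_cong[OF inv(1)], of w v] that
    by (simp add: E_op_def tensor_map_def left_mult_def right_mult_def skew_part_pair dual_mult
        del: minus_apply)
  have F: "v (P (w \<circ> (\<lambda>z. rt z x))) - v (star x (P w)) = 0" if "w \<in> D" "v \<in> D" for v w
    using fun_cong[OF fun_cong[OF inv(2)], of w v] that
    by (simp add: F_op_def tensor_map_def left_mult_def right_mult_def skew_part_pair dual_mult)
  show "P (u \<circ> (\<lambda>z. star z x)) = - lt x (P u)"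
    by (rule dual_separates) (use E[OF u] in \<open>simp add: dual_uminus add_eq_0_iff2\<close>)
  show "P (u \<circ> (\<lambda>z. rt z x)) = star x (P u)"
    by (rule dual_separates) (use F[OF u] in simp)
  show "P (u \<circ> lt x) = - star (P u) x"
  proof (rule dual_separates)
    fix v assume v: "v \<in> D"
    have "v (P (u \<circ> lt x)) = - (u (lt x (P v)))"
      using P_skew[OF dual_mult(2)[OF u] v, of x] by simp
    also have "\<dots> = u (P (v \<circ> (\<lambda>z. star z x)))" using E[OF v u] by (simp add: add_eq_0_iff2)
    also have "\<dots> = - v (star (P u) x)"
      using P_skew[OF dual_mult(6)[OF v] u, of x] by simp
    finally show "v (P (u \<circ> lt x)) = v (- star (P u) x)" using v by (simp add: dual_uminus)
  qed
  show "P (u \<circ> star x) = rt (P u) x"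
  proof (rule dual_separates)
    fix v assume v: "v \<in> D"
    have "v (P (u \<circ> star x)) = - (u (star x (P v)))"
      using P_skew[OF dual_mult(3)[OF u] v, of x] by simp
    also have "\<dots> = - u (P (v \<circ> (\<lambda>z. rt z x)))" using F[OF v u] by simp
    also have "\<dots> = v (rt (P u) x)"
      using P_skew[OF dual_mult(4)[OF v] u, of x] by simp
    finally show "v (P (u \<circ> star x)) = v (rt (P u) x)" .
  qed
qed

text \<open>Evaluating the DAYBE on three functionals turns its three double sums into products of
  contractions. The resulting trilinear identity is read below in each of its slots: the third gives
  \<open>R_rt\<close>, the first \<open>T_star\<close>, the second
  \<open>mixed_product\<close>.\<close>

lemma daybe_pairing:
  assumes uvw: "u \<in> D" "v \<in> D" "w \<in> D"
  shows "w (rt (R u) (R v)) = v (lt (T w) (R u)) + u (star (T v) (T w))"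
proof -
  obtain n :: nat and a b where r: "r = (\<Sum>i<n. tens2 scale (a i) (b i))"
    and eq: "(\<Sum>i<n. \<Sum>j<n. tens3 scale (a i) (a j) (rt (b i) (b j))
        - tens3 scale (a j) (lt (a i) (b j)) (b i)
        - tens3 scale (star (a i) (a j)) (b i) (b j)) = 0"
    by (rule daybe_representation)
  have 1: "w (rt (R u) (R v)) = (\<Sum>i<n. \<Sum>j<n. u (a i) * v (a j) * w (rt (b i) (b j)))"
    using uvw by (subst sum.swap) (simp add: contractions[OF r] product_sum product_linear
        dual_sum dual_scale sum_distrib_left mult_ac)
  have 2: "v (lt (T w) (R u)) = (\<Sum>i<n. \<Sum>j<n. u (a j) * v (lt (a i) (b j)) * w (b i))"
    using uvw by (subst sum.swap) (simp add: contractions[OF r] product_sum product_linear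
        dual_sum dual_scale sum_distrib_left mult_ac)
  have 3: "u (star (T v) (T w)) = (\<Sum>i<n. \<Sum>j<n. u (star (a i) (a j)) * v (b i) * w (b j))"
    using uvw by (subst sum.swap) (simp add: contractions[OF r] product_sum star_linear
        dual_sum dual_scale sum_distrib_left mult_ac)
  show ?thesis
    using fun_cong[OF fun_cong[OF fun_cong[OF eq, of u], of v], of w] uvw
    by (simp add: 1 2 3 sum_fun_apply tens3_def sum_subtractf diff_eq_eq add.commute)
qed

section \<open>The products on the dual and the multiplicativity of both contractions\<close>

lemma dual_rt_eq:
  "dual_rt scale rt lt r u v = (v \<circ> (\<lambda>z. lt z (R u))) + (u \<circ> star (T v))"
  by (auto simp: dual_rt_def dual_rep_def right_mult_def left_mult_def fun_eq_iff)

lemma dual_lt_eq: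
  "dual_lt scale rt lt r u v = (u \<circ> rt (T v)) - (v \<circ> (\<lambda>z. star z (R u)))"
  by (auto simp: dual_lt_def dual_rep_def right_mult_def left_mult_def fun_eq_iff)

lemma dual_products_closed:
  assumes "u \<in> D" "v \<in> D"
  shows "dual_rt scale rt lt r u v \<in> D" "dual_lt scale rt lt r u v \<in> D"
  using assms by (simp_all add: dual_rt_eq dual_lt_eq dual_closed dual_mult)

lemma R_rt:
  assumes "u \<in> D" "v \<in> D"
  shows "R (dual_rt scale rt lt r u v) = rt (R u) (R v)"
  by (rule dual_separates)
     (use assms in \<open>simp add: pairing dual_products_closed,
       simp add: dual_rt_eq daybe_pairing\<close>)

text \<open>At \<open>R w\<close>, the terms of the difference combine by
  \<open>star + lt = rt\<close> and \<open>star - rt = - lt\<close>, leaving exactly the two terms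
  that the DAYBE relates to \<open>star (T u) (T v)\<close>.\<close>

lemma T_star:
  assumes "u \<in> D" "v \<in> D"
  shows "T (dual_rt scale rt lt r u v - dual_lt scale rt lt r u v) = star (T u) (T v)"
proof (rule dual_separates)
  fix w assume w: "w \<in> D"
  have "w (T (dual_rt scale rt lt r u v - dual_lt scale rt lt r u v))
      = dual_rt scale rt lt r u v (R w) - dual_lt scale rt lt r u v (R w)"
    using assms w by (simp add: dual_products_closed dual_closed flip: pairing)
  also have "\<dots> = v (rt (R w) (R u)) - u (lt (T v) (R w))"
    using assms by (simp add: dual_rt_eq dual_lt_eq star_prod_def dual_diff)
  finally show "w (T (dual_rt scale rt lt r u v - dual_lt scale rt lt r u v))
      = w (star (T u) (T v))"
    using daybe_pairing[of w u v] assms w by simp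
qed

text \<open>The DAYBE is solved for its middle slot. Since one factor is a \<open>T\<close> and the
  other an \<open>R\<close>, this is the starting point for both \<open>R_lt\<close> and
  \<open>T_lt\<close>.\<close>

lemma mixed_product:
  assumes u: "u \<in> D" and v: "v \<in> D"
  shows "lt (T u) (R v) = T (u \<circ> rt (R v)) - R (v \<circ> (\<lambda>z. star z (T u)))"
proof (rule dual_separates)
  fix w assume w: "w \<in> D"
  have "w (T (u \<circ> rt (R v))) = u (rt (R v) (R w))"
    using pairing[OF w dual_mult(1)[OF u]] by simp
  moreover have "w (R (v \<circ> (\<lambda>z. star z (T u)))) = v (star (T w) (T u))"
    using pairing[OF dual_mult(6)[OF v] w] by simp
  ultimately show "w (lt (T u) (R v)) = w (T (u \<circ> rt (R v)) - R (v \<circ> (\<lambda>z. star z (T u))))"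
    using daybe_pairing[OF v w u] w by (simp add: dual_diff)
qed

text \<open>Since \<open>rt = star + lt\<close>, the last two identities of
  \<open>invariance\<close> add up to \<open>rt - star = lt\<close>.\<close>

lemma P_rt: "u \<in> D \<Longrightarrow> P (u \<circ> rt x) = lt (P u) x"
proof -
  assume u: "u \<in> D"
  have "u \<circ> rt x = (u \<circ> star x) + (u \<circ> lt x)"
    using u by (auto simp: fun_eq_iff star_prod_def dual_diff)
  then have "P (u \<circ> rt x) = P (u \<circ> star x) + P (u \<circ> lt x)"
    using u by (simp add: contraction_linear dual_mult)
  then show ?thesis using u by (simp add: invariance star_prod_def)
qed

text \<open>Expanding \<open>P = R - T\<close> here shows that \<open>R\<close> and \<open>T\<close>
  may be interchanged in \<open>dual_lt\<close>: it also equals \<open>u \<circ> rt (R v)\<close>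
  minus \<open>v \<circ> (\<lambda>z. star z (T u))\<close>, the two functionals that occur in
  \<open>mixed_product\<close>.\<close>

lemma P_cancel:
  assumes "u \<in> D" "v \<in> D"
  shows "(u \<circ> rt (P v)) + (v \<circ> (\<lambda>z. star z (P u))) = 0"
proof
  fix x
  have "v (star x (P u)) = v (P (u \<circ> (\<lambda>z. rt z x)))" using assms by (simp add: invariance)
  also have "\<dots> = - (u \<circ> (\<lambda>z. rt z x)) (P v)" using assms by (intro P_skew dual_mult)
  finally show "((u \<circ> rt (P v)) + (v \<circ> (\<lambda>z. star z (P u)))) x = 0 x" by simp
qed

lemma dual_mult_diff:
  assumes "u \<in> D"
  shows "u \<circ> rt (x - y) = (u \<circ> rt x) - (u \<circ> rt y)"
    "u \<circ> (\<lambda>z. star z (x - y)) = (u \<circ> (\<lambda>z. star z x)) - (u \<circ> (\<lambda>z. star z y))"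
  using assms by (auto simp: fun_eq_iff product_diff dual_diff)

text \<open>After the interchange given by \<open>P_cancel\<close>, the left-hand side exceeds
  \<open>mixed_product\<close> by \<open>P (u \<circ> rt (R v)) = lt (P u) (R v)\<close>, and
  \<open>T u + P u = R u\<close>.\<close>

lemma R_lt:
  assumes u: "u \<in> D" and v: "v \<in> D"
  shows "R (dual_lt scale rt lt r u v) = lt (R u) (R v)"
proof -
  note D = dual_mult[OF u] dual_mult[OF v]
  have "R (u \<circ> rt (P v)) + R (v \<circ> (\<lambda>z. star z (P u))) = R (0 :: 'a \<Rightarrow> 'f)"
    using P_cancel[OF u v] D by (simp flip: contraction_linear)
  \<comment> \<open>\<open>R 0 = 0\<close> is read off from
    \<open>R (u - u) = R u - R u\<close>.\<close>
  also have "\<dots> = 0" using R_linear(2)[OF u u] by simp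
  finally have c: "R (u \<circ> rt (R v)) - R (u \<circ> rt (T v)) + R (v \<circ> (\<lambda>z. star z (R u)))
      - R (v \<circ> (\<lambda>z. star z (T u))) = 0"
    using u v D by (simp add: dual_mult_diff contraction_linear algebra_simps)
  have p: "R (u \<circ> rt (R v)) - T (u \<circ> rt (R v)) = lt (R u) (R v) - lt (T u) (R v)"
    using P_rt[OF u, of "R v"] by (simp add: product_diff)
  show ?thesis
    using c p mixed_product[OF u v] D
    by (simp add: dual_lt_eq contraction_linear algebra_simps)
qed

text \<open>Now the excess over \<open>mixed_product\<close> is
  \<open>P (v \<circ> (\<lambda>z. star z (T u))) = - lt (T u) (P v)\<close>, and
  \<open>R v - P v = T v\<close>.\<close>

lemma T_lt:
  assumes u: "u \<in> D" and v: "v \<in> D"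
  shows "T (dual_lt scale rt lt r u v) = lt (T u) (T v)"
proof -
  note D = dual_mult[OF u] dual_mult[OF v]
  have "T (u \<circ> rt (P v)) + T (v \<circ> (\<lambda>z. star z (P u))) = T (0 :: 'a \<Rightarrow> 'f)"
    using P_cancel[OF u v] D by (simp flip: contraction_linear)
  also have "\<dots> = 0" using T_linear(2)[OF u u] by simp
  finally have c: "T (u \<circ> rt (R v)) - T (u \<circ> rt (T v)) + T (v \<circ> (\<lambda>z. star z (R u)))
      - T (v \<circ> (\<lambda>z. star z (T u))) = 0"
    using u v D by (simp add: dual_mult_diff contraction_linear algebra_simps)
  have p: "R (v \<circ> (\<lambda>z. star z (T u))) - T (v \<circ> (\<lambda>z. star z (T u)))
      = lt (T u) (T v) - lt (T u) (R v)"
    using invariance(1)[OF v, of "T u"] by (simp add: product_diff)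
  show ?thesis
    using c p mixed_product[OF u v] D
    by (simp add: dual_lt_eq contraction_linear algebra_simps)
qed

text \<open>Adding \<open>T_lt\<close> to \<open>T_star\<close> recovers
  \<open>rt = star + lt\<close>.\<close>

lemma T_rt:
  assumes u: "u \<in> D" and v: "v \<in> D"
  shows "T (dual_rt scale rt lt r u v) = rt (T u) (T v)"
  using T_star[OF u v] T_lt[OF u v] dual_products_closed[OF u v]
  by (simp add: contraction_linear star_prod_def)

section \<open>The embedding of the dual into the direct sum, and its image\<close>

definition J :: "('a \<Rightarrow> 'f) \<Rightarrow> 'a \<times> 'a" where
  "J u = (R u, T u)"

lemma image_J: "image_sum scale r = J ` D"
  by (auto simp: image_sum_def J_def)

text \<open>The difference of the two components of \<open>J u\<close> is \<open>P u\<close>, which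
  already determines \<open>u\<close>.\<close>

lemma inj_on_J: "inj_on J D"
  using bij_P by (auto simp: bij_betw_def inj_on_def J_def)

lemma J_hom:
  "u \<in> D \<Longrightarrow> v \<in> D \<Longrightarrow> J (u + v) = J u + J v"
  "u \<in> D \<Longrightarrow> J (fun_scale c u) = prod_scale scale c (J u)"
  "u \<in> D \<Longrightarrow> v \<in> D \<Longrightarrow> J (dual_rt scale rt lt r u v) = prod_mult rt (J u) (J v)"
  "u \<in> D \<Longrightarrow> v \<in> D \<Longrightarrow> J (dual_lt scale rt lt r u v) = prod_mult lt (J u) (J v)"
  by (simp_all add: J_def contraction_linear prod_scale_Pair vector_space_axioms
      prod_mult_def R_rt R_lt T_rt T_lt)

text \<open>The inverse of \<open>P\<close> exhibits the dual as a linear image of A, as needed for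
  finite dimension.\<close>

lemma inverse_P:
  obtains Q where "Vector_Spaces.linear scale fun_scale Q" "range Q = D"
proof
  define Q where "Q = inv_into D P"
  have Q: "Q x \<in> D" "P (Q x) = x" for x
    using bij_P unfolding Q_def bij_betw_def
    by (simp_all add: inv_into_into f_inv_into_f[of x P D])
  have Q_eqI: "Q x = u" if "u \<in> D" "P u = x" for x u
    using that bij_P inv_into_f_f[of P D u] by (simp add: Q_def bij_betw_def)
  have "Q (x + y) = Q x + Q y" for x y
    by (rule Q_eqI) (use Q[of x] Q[of y] in
      \<open>simp_all add: dual_closed contraction_linear algebra_simps\<close>)
  moreover have "Q (scale c x) = fun_scale c (Q x)" for c x
    by (rule Q_eqI) (use Q[of x] in
      \<open>simp_all add: dual_closed contraction_linear flip: scale_right_diff_distrib\<close>)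
  ultimately show "Vector_Spaces.linear scale fun_scale Q"
    using vector_space_axioms vector_space_fun_scale by (auto simp: Vector_Spaces.linear_iff)
  have "u \<in> range Q" if "u \<in> D" for u
    using Q_eqI[OF that refl] by (rule range_eqI[OF sym])
  then show "range Q = D" using Q(1) by auto
qed

lemma fin_dim: "fin_dim_space scale UNIV"
  using dialgebra by (simp add: dialgebra_on_def)

lemma fin_dim_dual: "fin_dim_space fun_scale D"
  by (rule inverse_P) (use fin_dim_space_image[OF fin_dim] in force)

lemma fin_dim_image: "fin_dim_space (prod_scale scale) (image_sum scale r)"
proof -
  obtain Q where Q: "Vector_Spaces.linear scale fun_scale Q" "range Q = D"
    by (rule inverse_P)
  then have "Q x \<in> D" for x by auto
  \<comment> \<open>\<open>J\<close> is known to respect the operations only on the dual, whereas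
    \<open>linear\<close> speaks of a whole type; precomposing with \<open>Q\<close>, whose values
    all lie in the dual, gives a linear map on all of A.\<close>
  then have "Vector_Spaces.linear scale (prod_scale scale) (J \<circ> Q)"
    using Q(1) fin_dim_space_prod[OF fin_dim]
    by (simp add: Vector_Spaces.linear_iff J_hom fin_dim_space_def)
  from fin_dim_space_image[OF fin_dim this] show ?thesis
    by (simp only: image_J image_comp[symmetric] Q(2))
qed

lemma subdialgebra_image:
  "subdialgebra (image_sum scale r) (prod_scale scale) UNIV (prod_mult rt) (prod_mult lt)"
  unfolding subdialgebra_def using dialgebra_on_prod[OF dialgebra] fin_dim_image
  by (auto simp: fin_dim_space_def image_J dual_products_closed simp flip: J_hom)

lemma dialgebra_on_image:
  "dialgebra_on (prod_scale scale) (image_sum scale r) (prod_mult rt) (prod_mult lt)"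
  using dialgebra_on_prod[OF dialgebra] fin_dim_image inj_on_id
  by (rule dialgebra_on_pullback) (use subdialgebra_image in \<open>auto simp: subdialgebra_def\<close>)

text \<open>The dual products are only known to be closed and to be carried by \<open>J\<close> to
  the componentwise products; the dialgebra laws are pulled back from A \<oplus> A.\<close>

lemma dialgebra_on_dual:
  "dialgebra_on fun_scale D (dual_rt scale rt lt r) (dual_lt scale rt lt r)"
  using dialgebra_on_prod[OF dialgebra] fin_dim_dual inj_on_J
  by (rule dialgebra_on_pullback) (simp_all add: J_hom dual_products_closed)

lemma isomorphic_image_dual:
  "dialgebra_isomorphic (prod_scale scale) (image_sum scale r) (prod_mult rt) (prod_mult lt)
     fun_scale D (dual_rt scale rt lt r) (dual_lt scale rt lt r)"
proof -
  \<comment> \<open>The isomorphism has to run from the image to the dual, so the witness is the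
    inverse of \<open>J\<close>.\<close>
  have bij: "bij_betw (inv_into D J) (image_sum scale r) D"
    using inj_on_J by (simp add: bij_betw_inv_into inj_on_imp_bij_betw image_J)
  have "inv_into D J (J u) = u" if "u \<in> D" for u
    using that inj_on_J by simp
  then show ?thesis
    unfolding dialgebra_isomorphic_def
    using dialgebra_on_image dialgebra_on_dual bij
    by (intro conjI exI[of _ "inv_into D J"])
      (auto simp: image_J dual_products_closed dual_closed simp flip: J_hom)
qed

text \<open>A pair \<open>J u\<close> in the image decomposes x exactly when \<open>P u = x\<close>,
  so existence and uniqueness are surjectivity and injectivity of \<open>P\<close>.\<close>

lemma unique_decomposition: "\<exists>!p. p \<in> image_sum scale r \<and> x = fst p - snd p"
proof -
  obtain u where u: "u \<in> D" "P u = x" "\<And>w. w \<in> D \<Longrightarrow> P w = x \<Longrightarrow> w = u"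
    using bij_P unfolding bij_betw_iff_bijections by (metis UNIV_I)
  show ?thesis
  proof (rule ex1I[of _ "J u"])
    show "p = J u" if "p \<in> image_sum scale r \<and> x = fst p - snd p" for p
      using that u(3) by (auto simp: image_J J_def)
  qed (use u(1,2) in \<open>auto simp: image_J J_def\<close>)
qed

end

theorem proposition4p18:
  fixes scale :: "'f::field_char_0 \<Rightarrow> 'a::ab_group_add \<Rightarrow> 'a"
    and rt lt :: "'a \<Rightarrow> 'a \<Rightarrow> 'a"
    and r :: "('a, 'f) tensor2"
  assumes "factorizable_bidialgebra scale rt lt r"
  shows "subdialgebra (image_sum scale r) (prod_scale scale) UNIV (prod_mult rt) (prod_mult lt)
       \<and> dialgebra_isomorphic
           (prod_scale scale) (image_sum scale r) (prod_mult rt) (prod_mult lt)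
           fun_scale (dual scale) (dual_rt scale rt lt r) (dual_lt scale rt lt r)
       \<and> (\<forall>x. \<exists>!p. p \<in> image_sum scale r \<and> x = fst p - snd p)"
proof -
  interpret factorizable scale rt lt r by unfold_locales fact
  show ?thesis using subdialgebra_image isomorphic_image_dual unique_decomposition by blast
qed

end
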